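(* Let $k\ge 1$ be an integer, let $\alpha_1,\dots,\alpha_k>-1$, and let $f(x_1,y_1,\dots,x_k,y_k)$ be a function of $2k$ complex variables that is analytic at $(0,0,\dots,0)\in\mathbb{C}^{2k}$. Then $f$ can be expanded as $$f(x_1,y_1,\dots,x_k,y_k)=\sum_{n_1,\dots,n_k=0}^{\infty}\lambda_{n_1,\dots,n_k}\,L_{n_1}^{(\alpha_1)}(x_1,y_1)\cdots L_{n_k}^{(\alpha_k)}(x_k,y_k),$$ where the coefficients $\lambda_{n_1,\dots,n_k}$ are independent of $x_1,y_1,\dots,x_k,y_k$, if and only if $f$ satisfies the $q$-partial differential equations $$\mathcal{D}_{q,x_j}(1-q^{\alpha_j}\eta_{x_j})\{f\}=-q^{\alpha_j+1}\,\eta_{x_j}^2\,\mathcal{D}_{q,y_j}\{f\}\qquad\text{for all } j\in\{1,2,\dots,k\}.$$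
   Context: Fix $q$ with $0<|q|<1$; real powers $q^{s}$ are taken with respect to a fixed choice of $\log q$. $(a;q)_0=1$, $(a;q)_n=\prod_{i=0}^{n-1}(1-aq^i)$, and $\begin{bmatrix} n\\ k\end{bmatrix}=\frac{(q;q)_n}{(q;q)_k(q;q)_{n-k}}$. The homogeneous $q$-Laguerre polynomials are, for $\alpha>-1$ and $n\ge 0$, $$L_n^{(\alpha)}(x,y)=\sum_{k=0}^n\begin{bmatrix} n\\ k\end{bmatrix}\frac{q^{k^2+k\alpha}}{(q^{\alpha+1};q)_k}(-x)^k y^{n-k}.$$ The $q$-partial derivative in a variable $x$ (other variables held constant) is $\mathcal{D}_{q,x}\{f\}=\frac{f(x)-f(qx)}{x}$ (extended to $x=0$ by continuity for analytic $f$). The $q$-shift operator $\eta_x^r$ replaces $x$ by $q^r x$. A product of operators is composition, e.g. $\mathcal{D}_{q,x}(1-q^\alpha\eta_x)\{f\}=\mathcal{D}_{q,x}\{f(x,y)-q^\alpha f(qx,y)\}$. Expansions and equations are understood to hold in a neighbourhood of the origin, with the expansion converging absolutely there. *)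

theory Defs
  imports "HOL-Analysis.Analysis"
begin

(* Real powers q^s are taken with respect to a chosen logarithm lq of q, i.e. exp lq = q;
   lq need not be the principal value, so powr (which uses Ln) is not appropriate. *)
definition qpower :: "complex \<Rightarrow> real \<Rightarrow> complex" where
  "qpower lq s = exp (of_real s * lq)"

definition qpochhammer :: "complex \<Rightarrow> complex \<Rightarrow> nat \<Rightarrow> complex" where
  "qpochhammer a q n = (\<Prod>i<n. 1 - a * q ^ i)"

(* Only used for k \<le> n. *)
definition qbinomial :: "complex \<Rightarrow> nat \<Rightarrow> nat \<Rightarrow> complex" where
  "qbinomial q n k = qpochhammer q q n / (qpochhammer q q k * qpochhammer q q (n - k))"

definition qLaguerre ::
    "complex \<Rightarrow> complex \<Rightarrow> real \<Rightarrow> nat \<Rightarrow> complex \<Rightarrow> complex \<Rightarrow> complex" where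
  "qLaguerre q lq \<alpha> n x y =
     (\<Sum>k\<le>n. qbinomial q n k
        * (qpower lq ((real k)\<^sup>2 + real k * \<alpha>) / qpochhammer (qpower lq (\<alpha> + 1)) q k)
        * (- x) ^ k * y ^ (n - k))"

(* At 0 the difference quotient is extended by continuity. *)
definition qderiv :: "complex \<Rightarrow> (complex \<Rightarrow> complex) \<Rightarrow> complex \<Rightarrow> complex" where
  "qderiv q g x =
     (if x = 0 then Lim (at 0) (\<lambda>t. (g t - g (q * t)) / t) else (g x - g (q * x)) / x)"

(* A function of the 2k variables x_1, y_1, ..., x_k, y_k is a function of the two vectors
   (x_1, ..., x_k) and (y_1, ..., y_k), indexed by a finite type 'k with k = CARD('k). *)
type_synonym 'k cfun2 = "complex ^ 'k \<Rightarrow> complex ^ 'k \<Rightarrow> complex"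

definition set_coord :: "complex ^ 'k \<Rightarrow> 'k \<Rightarrow> complex \<Rightarrow> complex ^ 'k" where
  "set_coord v j t = (\<chi> i. if i = j then t else v $ i)"

definition qderiv_x :: "complex \<Rightarrow> 'k \<Rightarrow> ('k::finite) cfun2 \<Rightarrow> 'k cfun2" where
  "qderiv_x q j f = (\<lambda>x y. qderiv q (\<lambda>t. f (set_coord x j t) y) (x $ j))"

definition qderiv_y :: "complex \<Rightarrow> 'k \<Rightarrow> ('k::finite) cfun2 \<Rightarrow> 'k cfun2" where
  "qderiv_y q j f = (\<lambda>x y. qderiv q (\<lambda>t. f x (set_coord y j t)) (y $ j))"

definition qshift_x :: "complex \<Rightarrow> nat \<Rightarrow> 'k \<Rightarrow> ('k::finite) cfun2 \<Rightarrow> 'k cfun2" where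
  "qshift_x q r j f = (\<lambda>x y. f (set_coord x j (q ^ r * x $ j)) y)"

definition abs_has_sum :: "('i \<Rightarrow> complex) \<Rightarrow> complex \<Rightarrow> bool" where
  "abs_has_sum g s \<longleftrightarrow> (\<lambda>i. norm (g i)) summable_on UNIV \<and> (g has_sum s) UNIV"

(* Analyticity at the origin of C^(2k): near 0, f is the sum of an absolutely convergent
   power series; m and n are the multi-indices of the exponents of x and y. *)
definition analytic_at_origin :: "('k::finite) cfun2 \<Rightarrow> bool" where
  "analytic_at_origin f \<longleftrightarrow>
     (\<exists>c :: ('k \<Rightarrow> nat) \<times> ('k \<Rightarrow> nat) \<Rightarrow> complex.
        \<forall>\<^sub>F (x, y) in nhds (0, 0).
          abs_has_sum
            (\<lambda>(m, n). c (m, n) * (\<Prod>j\<in>UNIV. x $ j ^ m j) * (\<Prod>j\<in>UNIV. y $ j ^ n j))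
            (f x y))"

end

theory Submission
  imports Defs
begin

text \<open>
  Write \<open>f\<close> as a power series with coefficients \<open>c(m, n)\<close> of \<open>x\<^sup>m y\<^sup>n\<close>. By uniqueness of the
  coefficients, the \<open>j\<close>-th equation is a two-term recurrence which trades one unit of \<open>n\<^sub>j\<close> for one
  unit of \<open>m\<^sub>j\<close>. All factors on its left-hand side are nonzero because \<open>\<alpha>\<^sub>j > -1\<close>, so the recurrences
  determine \<open>c\<close> from \<open>c(0, m + n)\<close>, and the ratio is the product of the coefficients
  of the q-Laguerre polynomials. The two series may be rearranged into each other because those
  coefficients are bounded, which gives \<open>|L\<^sub>n(x, y)| \<le> C (|x| + |y|)\<^sup>n\<close>; absolute convergence of
  \<open>\<Sum> c(0, N) y\<^sup>N\<close> near the origin is known in both directions, since \<open>L\<^sub>n(0, y) = y\<^sup>n\<close>.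
\<close>

subsection \<open>q-derivatives of power series in one variable\<close>

text \<open>
  A power series whose terms are indexed by an arbitrary set, the exponent of term \<open>i\<close> being \<open>e i\<close>:
  with \<open>e\<close> a coordinate of a multi-index, this covers power series in several variables with all
  but one variable held constant.
\<close>

lemma tendsto_powser_zero:
  fixes b :: "'i \<Rightarrow> complex" and e :: "'i \<Rightarrow> nat"
  assumes "0 < R"
    and sum: "\<And>t. norm t < R \<Longrightarrow> ((\<lambda>i. b i * t ^ e i) has_sum h t) A"
  shows "(h \<longlongrightarrow> h 0) (at 0)"
proof -
  define \<rho> where "\<rho> = R / 2"
  have \<rho>: "0 < \<rho>" "\<rho> < R" using \<open>0 < R\<close> by (auto simp: \<rho>_def)
  define M where "M = infsum (\<lambda>i. norm (b i * of_real \<rho> ^ e i)) A"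
  have "(\<lambda>i. b i * of_real \<rho> ^ e i) summable_on A"
    using sum[of "of_real \<rho>"] \<rho> by (auto simp: summable_on_def)
  hence M: "((\<lambda>i. norm (b i * of_real \<rho> ^ e i)) has_sum M) A"
    unfolding M_def summable_on_iff_abs_summable_on_complex by (rule has_sum_infsum)
  \<comment> \<open>In \<open>h t - h 0\<close> the terms of exponent 0 cancel. Every other term has
    a factor \<open>t\<close>, so it is at most \<open>norm t / \<rho>\<close> times its absolute
    value at \<open>\<rho>\<close>, and those values sum to \<open>M\<close>.\<close>
  have bound: "norm (h t - h 0) \<le> norm t / \<rho> * M" if t: "norm t < \<rho>" for t
  proof (rule norm_infsum_le)
    show "((\<lambda>i. b i * t ^ e i - b i * 0 ^ e i) has_sum (h t - h 0)) A"
      using has_sum_add[OF sum[of t] has_sum_uminusI[OF sum[of 0]]] t \<rho> by simp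
    show "((\<lambda>i. norm t / \<rho> * norm (b i * of_real \<rho> ^ e i)) has_sum norm t / \<rho> * M) A"
      by (rule has_sum_cmult_right[OF M])
    show "norm (b i * t ^ e i - b i * 0 ^ e i) \<le> norm t / \<rho> * norm (b i * of_real \<rho> ^ e i)" for i
    proof (cases "e i")
      case (Suc k)
      have "norm t ^ k \<le> \<rho> ^ k" using t by (intro power_mono) auto
      hence "norm (b i) * (norm t * norm t ^ k) \<le> norm (b i) * (norm t * \<rho> ^ k)"
        by (intro mult_left_mono) auto
      thus ?thesis using Suc \<rho> by (simp add: norm_mult norm_power field_simps)
    qed (use \<rho> in auto)
  qed
  have "((\<lambda>t. h t - h 0) \<longlongrightarrow> 0) (at 0)"
  proof (rule Lim_null_comparison)
    show "\<forall>\<^sub>F t in at 0. norm (h t - h 0) \<le> norm t / \<rho> * M"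
      using bound \<rho> by (auto simp: eventually_at intro!: exI[of _ \<rho>])
    show "((\<lambda>t. norm t / \<rho> * M) \<longlongrightarrow> 0) (at (0::complex))"
      using \<rho> by (auto intro!: tendsto_eq_intros)
  qed
  thus ?thesis by (simp add: LIM_zero_iff)
qed

text \<open>Once the lower coefficients vanish, dividing the series by \<open>t ^ n\<close> leaves a
  power series that is 0 off the origin and \<open>b n\<close> at the origin; continuity at 0 forces
  \<open>b n = 0\<close>.\<close>

lemma powser_zero_imp_coeff_zero:
  fixes b :: "nat \<Rightarrow> complex"
  assumes "0 < R"
    and sum: "\<And>t. norm t < R \<Longrightarrow> ((\<lambda>n. b n * t ^ n) has_sum 0) UNIV"
  shows "b n = 0"
proof (induction n rule: less_induct)
  case (less n)
  define h where "h t = (if t = 0 then b n else 0)" for t :: complex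
  have "((\<lambda>i. b (i + n) * t ^ i) has_sum h t) UNIV" if t: "norm t < R" for t
  proof (cases "t = 0")
    case True
    have "((\<lambda>i. b (i + n) * t ^ i) has_sum (\<Sum>i\<in>{0}. b (i + n) * t ^ i)) UNIV"
      by (rule has_sum_finite_neutralI[of "{0}"]) (simp_all add: True power_0_left)
    thus ?thesis using True by (simp add: h_def)
  next
    case False
    have "((\<lambda>k. b k * t ^ k) has_sum 0) (range (\<lambda>i. i + n))"
    proof (rule has_sum_cong_neutral[THEN iffD1, OF _ _ _ sum[OF t]])
      fix k assume "k \<in> UNIV - range (\<lambda>i. i + n)"
      hence "k < n" by (metis DiffD2 le_add_diff_inverse2 not_le rangeI)
      thus "b k * t ^ k = 0" using less by simp
    qed auto
    hence "((\<lambda>i. b (i + n) * t ^ i * t ^ n) has_sum 0) UNIV"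
      by (subst (asm) has_sum_reindex) (auto simp: o_def power_add mult.assoc)
    thus ?thesis using False by (simp add: has_sum_cmult_left_iff h_def)
  qed
  hence "(h \<longlongrightarrow> h 0) (at 0)" by (rule tendsto_powser_zero[OF \<open>0 < R\<close>])
  moreover have "h 0 = b n" by (simp add: h_def)
  ultimately have "(h \<longlongrightarrow> b n) (at 0)" by simp
  moreover have "(h \<longlongrightarrow> 0) (at 0)"
    by (rule tendsto_eventually) (auto simp: h_def eventually_at intro!: exI[of _ 1])
  ultimately show ?case by (rule tendsto_unique[OF trivial_limit_at])
qed

text \<open>Off the origin this is the difference quotient taken term by term. At the origin the
  limit in \<open>qderiv\<close> is found from the continuity of the differentiated series. The
  truncated exponent \<open>e i - 1\<close> does no harm, since
  \<open>1 - q ^ 0 = 0\<close>.\<close>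

lemma has_sum_qderiv:
  fixes b :: "'i \<Rightarrow> complex" and e :: "'i \<Rightarrow> nat"
  assumes "norm q < 1" and "norm x < R"
    and sum: "\<And>t. norm t < R \<Longrightarrow> ((\<lambda>i. b i * t ^ e i) has_sum g t) A"
  shows "((\<lambda>i. b i * (1 - q ^ e i) * x ^ (e i - 1)) has_sum qderiv q g x) A"
proof -
  have R: "0 < R" using assms(2) by (meson le_less_trans norm_ge_zero)
  have quot: "((\<lambda>i. b i * (1 - q ^ e i) * t ^ (e i - 1)) has_sum (g t - g (q * t)) / t) A"
    if t: "norm t < R" "t \<noteq> 0" for t
  proof -
    have "norm (q * t) < R"
      using t assms(1) by (simp add: norm_mult) (meson le_less_trans less_imp_le mult_left_le_one_le norm_ge_zero)
    hence "((\<lambda>i. (b i * t ^ e i - b i * (q * t) ^ e i) / t) has_sum (g t - g (q * t)) / t) A"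
      using has_sum_cmult_left[OF has_sum_add[OF sum[OF t(1)] has_sum_uminusI[OF sum]],
          of "q * t" "1 / t"] by simp
    moreover have "(b i * t ^ e i - b i * (q * t) ^ e i) / t = b i * (1 - q ^ e i) * t ^ (e i - 1)" for i
      using t(2) by (cases "e i") (auto simp: field_simps power_mult_distrib)
    ultimately show ?thesis by simp
  qed
  show ?thesis
  proof (cases "x = 0")
    case False
    thus ?thesis using quot[of x] assms(2) by (simp add: qderiv_def)
  next
    case True
    define h where "h t = infsum (\<lambda>i. b i * (1 - q ^ e i) * t ^ (e i - 1)) A" for t
    \<comment> \<open>The quotient formula says nothing at 0, so summability there is obtained by
      comparison with the point \<open>R / 2\<close>: each term either vanishes at 0 or is the same
      at both points.\<close>
    have "(\<lambda>i. b i * (1 - q ^ e i) * 0 ^ (e i - 1)) summable_on A"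
      unfolding summable_on_iff_abs_summable_on_complex
    proof (rule Infinite_Sum.abs_summable_on_comparison_test)
      show "(\<lambda>i. norm (b i * (1 - q ^ e i) * of_real (R / 2) ^ (e i - 1))) summable_on A"
        using quot[of "of_real (R / 2)"] R
        by (subst summable_on_iff_abs_summable_on_complex[symmetric]) (auto simp: summable_on_def)
      show "norm (b i * (1 - q ^ e i) * 0 ^ (e i - 1))
          \<le> norm (b i * (1 - q ^ e i) * of_real (R / 2) ^ (e i - 1))" for i
        by (cases "e i - 1") auto
    qed
    moreover have "(\<lambda>i. b i * (1 - q ^ e i) * t ^ (e i - 1)) summable_on A"
      if "norm t < R" "t \<noteq> 0" for t
      using quot[OF that] by (rule has_sum_imp_summable)
    ultimately have h: "((\<lambda>i. b i * (1 - q ^ e i) * t ^ (e i - 1)) has_sum h t) A"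
      if "norm t < R" for t
      unfolding h_def using that by (intro has_sum_infsum) (cases "t = 0"; blast)
    have "(h \<longlongrightarrow> h 0) (at 0)" by (rule tendsto_powser_zero[OF R h])
    moreover have "\<forall>\<^sub>F t in at 0. h t = (g t - g (q * t)) / t"
      unfolding eventually_at
      using R h quot by (intro exI[of _ R]) (auto intro: has_sum_unique)
    ultimately have "((\<lambda>t. (g t - g (q * t)) / t) \<longlongrightarrow> h 0) (at 0)"
      by (simp only: tendsto_cong)
    hence "qderiv q g 0 = h 0" by (simp add: qderiv_def tendsto_Lim)
    thus ?thesis using h[of 0] R True by simp
  qed
qed

subsection \<open>Uniqueness of the coefficients of multivariate power series\<close>

definition vmonom :: "complex ^ 'k \<Rightarrow> ('k::finite \<Rightarrow> nat) \<Rightarrow> complex" where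
  "vmonom x m = (\<Prod>j\<in>UNIV. x $ j ^ m j)"

lemma vmonom_upd: "vmonom x (m(j := k)) = x $ j ^ k * vmonom x (m(j := 0))"
  unfolding vmonom_def by (simp add: prod.remove[of UNIV j])

lemma vmonom_split: "vmonom x m = x $ j ^ m j * vmonom x (m(j := 0))"
  using vmonom_upd[of x m j "m j"] by simp

lemma vmonom_set_coord: "vmonom (set_coord x j t) m = t ^ m j * vmonom x (m(j := 0))"
  unfolding vmonom_def by (simp add: prod.remove[of UNIV j] set_coord_def)

lemma set_coord_nth: "set_coord x j t $ i = (if i = j then t else x $ i)"
  by (simp add: set_coord_def)

text \<open>Induction on the set \<open>S\<close> of variables that may occur. Grouping by powers of
  a new variable \<open>x $ j\<close> gives a one-variable series, whose coefficients vanish; these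
  are series in the variables of \<open>S\<close>, to which the induction hypothesis applies.
  Restricting the support of the exponents avoids changing the index type.\<close>

lemma vmonom_series_coeff_zero_on:
  fixes a :: "('k::finite \<Rightarrow> nat) \<Rightarrow> complex" and S :: "'k set"
  assumes "0 < r"
    and "\<And>x. (\<And>j. norm (x $ j) < r) \<Longrightarrow>
           ((\<lambda>m. a m * vmonom x m) has_sum 0) {m. \<forall>i. i \<notin> S \<longrightarrow> m i = 0}"
    and "\<forall>i. i \<notin> S \<longrightarrow> m i = 0"
  shows "a m = 0"
  using finite[of S] assms(2,3)
proof (induction S arbitrary: a m rule: finite_induct)
  case empty
  have "{m :: 'k \<Rightarrow> nat. \<forall>i. i \<notin> {} \<longrightarrow> m i = 0} = {\<lambda>_. 0}" by auto
  moreover have "m = (\<lambda>_. 0)" using empty by auto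
  ultimately show ?case
    using empty(1)[of 0] \<open>0 < r\<close> by (simp add: has_sum_finite_iff vmonom_def)
next
  case (insert j S)
  define I where "I = {m :: 'k \<Rightarrow> nat. \<forall>i. i \<notin> S \<longrightarrow> m i = 0}"
  have upd0: "m(j := 0) = m" if "m \<in> I" for m using that insert(2) by (auto simp: I_def)
  have bij: "bij_betw (\<lambda>(n, m). m(j := n)) (UNIV \<times> I) {m. \<forall>i. i \<notin> insert j S \<longrightarrow> m i = 0}"
    by (rule bij_betw_byWitness[of _ "\<lambda>m. (m j, m(j := 0))"])
      (use insert(2) in \<open>auto simp: I_def fun_eq_iff\<close>)
  have coeff: "((\<lambda>m. a (m(j := n)) * vmonom x m) has_sum 0) I"
    if x: "\<And>i. norm (x $ i) < r" for x n
  proof -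
    have sum: "((\<lambda>(n, m). t ^ n * (a (m(j := n)) * vmonom x m)) has_sum 0) (UNIV \<times> I)"
      if t: "norm t < r" for t
    proof -
      have "((\<lambda>m. a m * vmonom (set_coord x j t) m) has_sum 0) {m. \<forall>i. i \<notin> insert j S \<longrightarrow> m i = 0}"
        by (rule insert.prems(1)) (use x t in \<open>auto simp: set_coord_nth\<close>)
      hence "((\<lambda>p. case p of (n, m) \<Rightarrow>
          a (m(j := n)) * vmonom (set_coord x j t) (m(j := n))) has_sum 0) (UNIV \<times> I)"
        by (subst (asm) has_sum_reindex_bij_betw[OF bij, symmetric]) (simp add: case_prod_unfold)
      also have "?this \<longleftrightarrow> ?thesis"
        by (rule has_sum_cong) (auto simp: vmonom_set_coord upd0)
      finally show ?thesis .
    qed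
    define b where "b n = infsum (\<lambda>m. a (m(j := n)) * vmonom x m) I" for n
    have b: "((\<lambda>m. a (m(j := n)) * vmonom x m) has_sum b n) I" for n
    proof -
      \<comment> \<open>The double series is used at the nonzero value \<open>r / 2\<close> of the
        \<open>j\<close>-th variable, so that its power can be divided out again.\<close>
      have "(\<lambda>m. complex_of_real (r / 2) ^ n * (a (m(j := n)) * vmonom x m)) summable_on I"
        by (rule summable_on_SigmaD1[of "\<lambda>n m. complex_of_real (r / 2) ^ n * (a (m(j := n)) * vmonom x m)" UNIV "\<lambda>_. I"])
          (use sum[of "of_real (r / 2)"] \<open>0 < r\<close> in \<open>auto simp: summable_on_def\<close>)
      hence "(\<lambda>m. inverse (complex_of_real (r / 2) ^ n) * (complex_of_real (r / 2) ^ n * (a (m(j := n)) * vmonom x m))) summable_on I"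
        by (rule summable_on_cmult_right)
      thus ?thesis using \<open>0 < r\<close> by (simp add: b_def flip: mult.assoc)
    qed
    have "b n = 0"
    proof (rule powser_zero_imp_coeff_zero[OF \<open>0 < r\<close>])
      fix t :: complex assume "norm t < r"
      have "((\<lambda>n. t ^ n * b n) has_sum 0) UNIV"
        by (rule has_sum_SigmaD[OF sum[OF \<open>norm t < r\<close>]]) (simp add: has_sum_cmult_right[OF b])
      thus "((\<lambda>n. b n * t ^ n) has_sum 0) UNIV" by (simp add: mult.commute)
    qed
    with b[of n] show ?thesis by simp
  qed
  have "a ((m(j := 0))(j := m j)) = 0"
  proof (rule insert.IH[of "\<lambda>m'. a (m'(j := m j))"])
    show "((\<lambda>m'. a (m'(j := m j)) * vmonom x m') has_sum 0) {m. \<forall>i. i \<notin> S \<longrightarrow> m i = 0}"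
      if "\<And>i. norm (x $ i) < r" for x
      using coeff[OF that, where n = "m j"] by (simp add: I_def)
    show "\<forall>i. i \<notin> S \<longrightarrow> (m(j := 0)) i = 0"
      using insert.prems(2) by simp
  qed
  thus ?case by (simp only: fun_upd_upd fun_upd_triv)
qed

lemma vmonom_series_coeff_zero:
  fixes a :: "('k::finite \<Rightarrow> nat) \<Rightarrow> complex"
  assumes "0 < r"
    and "\<And>x. (\<And>j. norm (x $ j) < r) \<Longrightarrow> ((\<lambda>m. a m * vmonom x m) has_sum 0) UNIV"
  shows "a m = 0"
proof (rule vmonom_series_coeff_zero_on[where S = UNIV and a = a, OF assms(1)])
  show "((\<lambda>m. a m * vmonom x m) has_sum 0) {m. \<forall>i. i \<notin> UNIV \<longrightarrow> m i = 0}"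
    if "\<And>j. norm (x $ j) < r" for x
    using assms(2)[OF that] by simp
qed simp

text \<open>Polydiscs form a neighbourhood base at the origin, because the norm of a pair of vectors
  is equivalent to the largest modulus of a coordinate. They suit power series better, since each
  coordinate can be varied independently.\<close>

lemma eventually_nhds_polydisc:
  fixes P :: "complex ^ 'k \<Rightarrow> complex ^ 'k \<Rightarrow> bool"
  shows "(\<forall>\<^sub>F (x, y) in nhds (0, 0). P x y) \<longleftrightarrow>
    (\<exists>r>0. \<forall>x y. (\<forall>j. norm (x $ j) < r) \<longrightarrow> (\<forall>j. norm (y $ j) < r) \<longrightarrow> P x y)"
proof
  assume "\<forall>\<^sub>F (x, y) in nhds (0, 0). P x y"
  then obtain d where d: "d > 0" "\<And>x y. norm (x, y) < d \<Longrightarrow> P x y"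
    by (auto simp: eventually_nhds_metric dist_norm)
  \<comment> \<open>Each vector then has norm below \<open>d / 2\<close>, and the pair has norm
    below \<open>d\<close>.\<close>
  define r where "r = d / (2 * real CARD('k))"
  have norm: "norm z < d / 2" if "\<And>j. norm (z $ j) < r" for z :: "complex ^ 'k"
  proof -
    have "norm z \<le> (\<Sum>j\<in>UNIV. norm (z $ j))" by (simp add: norm_vec_def L2_set_le_sum)
    also have "\<dots> < (\<Sum>j\<in>(UNIV :: 'k set). r)" by (rule sum_strict_mono) (use that in auto)
    finally show ?thesis by (simp add: r_def)
  qed
  have "P x y" if "\<forall>j. norm (x $ j) < r" "\<forall>j. norm (y $ j) < r" for x y
    using norm[of x] norm[of y] that norm_Pair_le[of x y] by (intro d(2)) force
  moreover have "r > 0" using d by (simp add: r_def)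
  ultimately show "\<exists>r>0. \<forall>x y. (\<forall>j. norm (x $ j) < r) \<longrightarrow> (\<forall>j. norm (y $ j) < r) \<longrightarrow> P x y"
    by blast
next
  assume "\<exists>r>0. \<forall>x y. (\<forall>j. norm (x $ j) < r) \<longrightarrow> (\<forall>j. norm (y $ j) < r) \<longrightarrow> P x y"
  then obtain r where r: "r > 0"
    "\<And>x y. (\<forall>j. norm (x $ j) < r) \<Longrightarrow> (\<forall>j. norm (y $ j) < r) \<Longrightarrow> P x y" by blast
  have "P x y" if "norm (x, y) < r" for x y
  proof (rule r(2); intro allI)
    show "norm (x $ j) < r" for j
      using Finite_Cartesian_Product.norm_nth_le[of x j] norm_fst_le[of x y] that by linarith
    show "norm (y $ j) < r" for j
      using Finite_Cartesian_Product.norm_nth_le[of y j] norm_snd_le[of y x] that by linarith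
  qed
  thus "\<forall>\<^sub>F (x, y) in nhds (0, 0). P x y"
    using r(1) by (auto simp: eventually_nhds_metric dist_norm)
qed

subsection \<open>Power series in two vector variables\<close>

text \<open>The radius is explicit so that the shifts and q-derivatives, which also evaluate
  \<open>f\<close> at other points, can be seen to keep the same polydisc. Convergence is absolute,
  as \<open>has_sum\<close> is unconditional.\<close>

definition has_pseries ::
    "real \<Rightarrow> ('k::finite) cfun2 \<Rightarrow> (('k \<Rightarrow> nat) \<Rightarrow> ('k \<Rightarrow> nat) \<Rightarrow> complex) \<Rightarrow> bool" where
  "has_pseries r f c \<longleftrightarrow>
     (\<forall>x y. (\<forall>j. norm (x $ j) < r) \<longrightarrow> (\<forall>j. norm (y $ j) < r) \<longrightarrow>
        ((\<lambda>(m, n). c m n * vmonom x m * vmonom y n) has_sum f x y) UNIV)"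

lemma has_pseriesD:
  assumes "has_pseries r f c" and "\<And>j. norm (x $ j) < r" and "\<And>j. norm (y $ j) < r"
  shows "((\<lambda>(m, n). c m n * vmonom x m * vmonom y n) has_sum f x y) UNIV"
  using assms by (simp add: has_pseries_def)

lemma has_pseries_mono:
  assumes "has_pseries r f c" and "s \<le> r"
  shows "has_pseries s f c"
  unfolding has_pseries_def
proof (intro allI impI)
  fix x y :: "complex ^ 'a"
  assume *: "\<forall>j. norm (x $ j) < s" "\<forall>j. norm (y $ j) < s"
  hence "norm (x $ j) < r" "norm (y $ j) < r" for j
    using assms(2) by (meson less_le_trans)+
  thus "((\<lambda>(m, n). c m n * vmonom x m * vmonom y n) has_sum f x y) UNIV"
    by (rule has_pseriesD[OF assms(1)])
qed

text \<open>Transfers the result on \<open>qderiv_x\<close> to \<open>qderiv_y\<close>.\<close>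

lemma has_pseries_swap:
  assumes "has_pseries r f c"
  shows "has_pseries r (\<lambda>x y. f y x) (\<lambda>m n. c n m)"
  unfolding has_pseries_def
proof (intro allI impI)
  fix x y :: "complex ^ 'a"
  assume "\<forall>j. norm (x $ j) < r" "\<forall>j. norm (y $ j) < r"
  hence "((\<lambda>(m, n). c m n * vmonom y m * vmonom x n) has_sum f y x) UNIV"
    by (intro has_pseriesD[OF assms]) auto
  from has_sum_reindex_bij_betw[OF bij_swap, THEN iffD2, OF this]
  show "((\<lambda>(m, n). c n m * vmonom x m * vmonom y n) has_sum f y x) UNIV"
    by (simp add: case_prod_unfold mult_ac)
qed

lemma has_pseries_diff:
  assumes "has_pseries r f c" "has_pseries r g d"
  shows "has_pseries r (\<lambda>x y. f x y - g x y) (\<lambda>m n. c m n - d m n)"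
  unfolding has_pseries_def
proof (intro allI impI)
  fix x y :: "complex ^ 'a"
  assume *: "\<forall>j. norm (x $ j) < r" "\<forall>j. norm (y $ j) < r"
  from has_sum_add[OF has_pseriesD[OF assms(1)] has_sum_uminusI[OF has_pseriesD[OF assms(2)]], of x y x y] *
  show "((\<lambda>(m, n). (c m n - d m n) * vmonom x m * vmonom y n) has_sum f x y - g x y) UNIV"
    by (simp add: case_prod_unfold left_diff_distrib)
qed

lemma has_pseries_cmult:
  assumes "has_pseries r f c"
  shows "has_pseries r (\<lambda>x y. a * f x y) (\<lambda>m n. a * c m n)"
  unfolding has_pseries_def
proof (intro allI impI)
  fix x y :: "complex ^ 'a"
  assume *: "\<forall>j. norm (x $ j) < r" "\<forall>j. norm (y $ j) < r"
  from has_sum_cmult_right[OF has_pseriesD[OF assms], of x y a] *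
  show "((\<lambda>(m, n). a * c m n * vmonom x m * vmonom y n) has_sum a * f x y) UNIV"
    by (simp add: case_prod_unfold mult.assoc)
qed

lemma has_pseries_qshift_x:
  assumes "has_pseries r f c" and "norm q \<le> 1"
  shows "has_pseries r (qshift_x q s j f) (\<lambda>m n. q ^ (s * m j) * c m n)"
  unfolding has_pseries_def
proof (intro allI impI)
  fix x y :: "complex ^ 'a"
  assume *: "\<forall>j. norm (x $ j) < r" "\<forall>j. norm (y $ j) < r"
  have "norm (q ^ s * x $ j) \<le> norm (x $ j)"
    using assms(2) by (simp add: norm_mult norm_power mult_left_le_one_le power_le_one)
  hence "norm (q ^ s * x $ j) < r" by (rule le_less_trans) (use * in blast)
  hence "((\<lambda>(m, n). c m n * vmonom (set_coord x j (q ^ s * x $ j)) m * vmonom y n)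
      has_sum qshift_x q s j f x y) UNIV"
    unfolding qshift_x_def by (intro has_pseriesD[OF assms(1)]) (use * in \<open>auto simp: set_coord_nth\<close>)
  moreover have "vmonom (set_coord x j (q ^ s * x $ j)) m = q ^ (s * m j) * vmonom x m" for m
    by (simp add: vmonom_set_coord vmonom_split[of x m j] power_mult_distrib power_mult)
  ultimately show "((\<lambda>(m, n). q ^ (s * m j) * c m n * vmonom x m * vmonom y n)
      has_sum qshift_x q s j f x y) UNIV"
    by (simp add: mult_ac)
qed

text \<open>With all variables but \<open>x $ j\<close> fixed, \<open>has_sum_qderiv\<close>
  differentiates term by term. Terms with exponent 0 at \<open>j\<close> drop out, and the rest are
  reindexed by the injection \<open>h\<close>, which raises that exponent by one.\<close>

lemma has_pseries_qderiv_x: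
  assumes f: "has_pseries r f c" and "norm q < 1"
  shows "has_pseries r (qderiv_x q j f) (\<lambda>m n. (1 - q ^ Suc (m j)) * c (m(j := Suc (m j))) n)"
  unfolding has_pseries_def
proof (intro allI impI)
  fix x y :: "complex ^ 'a"
  assume *: "\<forall>j. norm (x $ j) < r" "\<forall>j. norm (y $ j) < r"
  define b where "b p = c (fst p) (snd p) * vmonom x ((fst p)(j := 0)) * vmonom y (snd p)" for p
  define F where "F p = b p * (1 - q ^ fst p j) * x $ j ^ (fst p j - 1)" for p
  define h :: "('a \<Rightarrow> nat) \<times> ('a \<Rightarrow> nat) \<Rightarrow> _" where "h p = ((fst p)(j := Suc (fst p j)), snd p)" for p
  have "(F has_sum qderiv_x q j f x y) UNIV"
    unfolding qderiv_x_def F_def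
  proof (rule has_sum_qderiv[OF \<open>norm q < 1\<close>])
    show "norm (x $ j) < r" using * by blast
    fix t :: complex assume "norm t < r"
    hence "((\<lambda>(m, n). c m n * vmonom (set_coord x j t) m * vmonom y n) has_sum f (set_coord x j t) y) UNIV"
      by (intro has_pseriesD[OF f]) (use * in \<open>auto simp: set_coord_nth\<close>)
    thus "((\<lambda>p. b p * t ^ fst p j) has_sum f (set_coord x j t) y) UNIV"
      by (simp add: b_def case_prod_unfold vmonom_set_coord mult_ac)
  qed
  hence "(F has_sum qderiv_x q j f x y) (range h)"
  proof (rule has_sum_cong_neutral[THEN iffD1, rotated -1])
    fix p assume "p \<in> UNIV - range h"
    moreover have "p = h ((fst p)(j := fst p j - 1), snd p)" if "fst p j > 0"
      using that by (cases p) (simp add: h_def)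
    ultimately have "fst p j = 0" by blast
    thus "F p = 0" by (simp add: F_def)
  qed auto
  moreover have "inj h"
  proof (rule injI)
    fix p p' assume eq: "h p = h p'"
    have "fst p i = fst p' i" for i
      using fun_cong[OF arg_cong[OF eq, of fst], of i] by (cases "i = j") (simp_all add: h_def)
    thus "p = p'" using eq by (auto simp: h_def prod_eq_iff)
  qed
  ultimately have "((\<lambda>p. F (h p)) has_sum qderiv_x q j f x y) UNIV"
    by (simp add: has_sum_reindex o_def)
  moreover have "F (h p) = (case p of (m, n) \<Rightarrow>
      (1 - q ^ Suc (m j)) * c (m(j := Suc (m j))) n * vmonom x m * vmonom y n)" for p
    using vmonom_split[of x "fst p" j] by (cases p) (simp add: F_def h_def b_def mult_ac)
  ultimately show "((\<lambda>(m, n). (1 - q ^ Suc (m j)) * c (m(j := Suc (m j))) n * vmonom x m * vmonom y n)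
      has_sum qderiv_x q j f x y) UNIV"
    by simp
qed

lemma has_pseries_qderiv_y:
  assumes "has_pseries r f c" and "norm q < 1"
  shows "has_pseries r (qderiv_y q j f) (\<lambda>m n. (1 - q ^ Suc (n j)) * c m (n(j := Suc (n j))))"
proof -
  have "qderiv_y q j f = (\<lambda>x y. qderiv_x q j (\<lambda>x y. f y x) y x)"
    by (simp add: qderiv_x_def qderiv_y_def)
  thus ?thesis
    using has_pseries_swap[OF has_pseries_qderiv_x[OF has_pseries_swap[OF assms(1)] assms(2)]] by simp
qed

text \<open>Uniqueness in one vector variable is applied twice to the difference of the series: for
  fixed \<open>y\<close> it is a power series in \<open>x\<close>, and each of its coefficients is a
  power series in \<open>y\<close>.\<close>

lemma has_pseries_unique:
  assumes "0 < r" and f: "has_pseries r f c" and g: "has_pseries r g d"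
    and eq: "\<And>x y. (\<And>j. norm (x $ j) < r) \<Longrightarrow> (\<And>j. norm (y $ j) < r) \<Longrightarrow> f x y = g x y"
  shows "c m n = d m n"
proof -
  define a where "a m n = c m n - d m n" for m n
  have *: "((\<lambda>(m, n). vmonom x m * (a m n * vmonom y n)) has_sum 0) (UNIV \<times> UNIV)"
    if "\<And>j. norm (x $ j) < r" "\<And>j. norm (y $ j) < r" for x y
    using has_pseriesD[OF has_pseries_diff[OF f g] that] eq[OF that]
    by (simp add: case_prod_unfold a_def mult_ac)
  \<comment> \<open>A point with no zero coordinate: its monomials can be divided out, which makes
    each inner series in \<open>y\<close> summable.\<close>
  define x0 :: "complex ^ 'a" where "x0 = (\<chi> j. of_real (r / 2))"
  have x0: "norm (x0 $ j) < r" "vmonom x0 m \<noteq> 0" for j m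
    using \<open>0 < r\<close> by (auto simp: x0_def vmonom_def)
  have inner: "((\<lambda>n. a m n * vmonom y n) has_sum 0) UNIV" if y: "\<And>j. norm (y $ j) < r" for y m
  proof -
    define b where "b m = infsum (\<lambda>n. a m n * vmonom y n) UNIV" for m
    have b: "((\<lambda>n. a m n * vmonom y n) has_sum b m) UNIV" for m
    proof -
      have "(\<lambda>n. vmonom x0 m * (a m n * vmonom y n)) summable_on UNIV"
        by (rule summable_on_SigmaD1[OF has_sum_imp_summable[OF *[OF x0(1) y]]]) auto
      from summable_on_cmult_right[OF this, of "inverse (vmonom x0 m)"]
      show ?thesis using x0(2) by (simp add: b_def flip: mult.assoc)
    qed
    have "b m = 0"
    proof (rule vmonom_series_coeff_zero[where a = b, OF \<open>0 < r\<close>])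
      fix x :: "complex ^ 'a" assume "\<And>j. norm (x $ j) < r"
      have "((\<lambda>m. vmonom x m * b m) has_sum 0) UNIV"
        by (rule has_sum_SigmaD[OF *[OF \<open>\<And>j. norm (x $ j) < r\<close> y]])
           (simp_all add: has_sum_cmult_right[OF b])
      thus "((\<lambda>m. b m * vmonom x m) has_sum 0) UNIV" by (simp add: mult.commute)
    qed
    with b[of m] show ?thesis by simp
  qed
  have "a m n = 0"
    by (rule vmonom_series_coeff_zero[where a = "a m", OF \<open>0 < r\<close> inner])
  thus ?thesis by (simp add: a_def)
qed

text \<open>Unconditional and absolute summability coincide for complex families.\<close>

lemma abs_has_sum_iff: "abs_has_sum g s \<longleftrightarrow> (g has_sum s) UNIV"
  using summable_on_iff_abs_summable_on_complex[of g UNIV]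
  by (auto simp: abs_has_sum_def dest: has_sum_imp_summable)

lemma analytic_at_origin_has_pseries:
  assumes "analytic_at_origin f"
  obtains r c where "0 < r" "has_pseries r f c"
proof -
  from assms obtain c r where "0 < r" and r: "\<And>x y. (\<forall>j. norm (x $ j) < r) \<Longrightarrow> (\<forall>j. norm (y $ j) < r) \<Longrightarrow>
      ((\<lambda>(m, n). c (m, n) * (\<Prod>j\<in>UNIV. x $ j ^ m j) * (\<Prod>j\<in>UNIV. y $ j ^ n j)) has_sum f x y) UNIV"
    unfolding analytic_at_origin_def eventually_nhds_polydisc abs_has_sum_iff by blast
  have "has_pseries r f (curry c)"
    using r unfolding has_pseries_def vmonom_def curry_def by blast
  with \<open>0 < r\<close> show ?thesis by (rule that)
qed

subsection \<open>Coefficients of the q-Laguerre polynomials\<close>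

lemma qpower_add: "qpower lq (s + t) = qpower lq s * qpower lq t"
  by (simp add: qpower_def distrib_right exp_add)

lemma qpower_of_nat: "exp lq = q \<Longrightarrow> qpower lq (real n) = q ^ n"
  by (auto simp: qpower_def exp_of_nat_mult)

lemma norm_qpower: "norm (qpower lq s) = norm (exp lq) powr s"
  by (simp add: qpower_def powr_def)

section \<open>q-Pochhammer symbols: nonvanishing and uniform bounds\<close>

lemma qpochhammer_Suc: "qpochhammer a q (Suc n) = qpochhammer a q n * (1 - a * q ^ n)"
  by (simp add: qpochhammer_def)

lemma one_minus_mult_power_nonzero:
  fixes a q :: complex
  assumes "norm a < 1" and "norm q < 1"
  shows "1 - a * q ^ n \<noteq> 0"
proof
  assume "1 - a * q ^ n = 0"
  hence "1 = norm a * norm q ^ n" by (metis eq_iff_diff_eq_0 norm_mult norm_one norm_power)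
  also have "\<dots> \<le> norm a" using assms by (intro mult_right_le_one_le) (auto intro: power_le_one)
  finally show False using assms by simp
qed

lemma qpochhammer_nonzero:
  assumes "norm a < 1" and "norm q < 1"
  shows "qpochhammer a q n \<noteq> 0"
  using one_minus_mult_power_nonzero[OF assms] by (simp add: qpochhammer_def)

text \<open>The infinite product converges absolutely by comparison with a geometric series, and a
  convergent product without zero factors is nonzero.\<close>

lemma qpochhammer_tendsto_nonzero:
  assumes "norm a < 1" and "norm q < 1"
  obtains L where "L \<noteq> 0" and "qpochhammer a q \<longlonglongrightarrow> L"
proof -
  have "abs_convergent_prod (\<lambda>n. 1 - a * q ^ n)"
    by (intro summable_imp_abs_convergent_prod)
       (use assms in \<open>simp add: norm_mult norm_power summable_geometric summable_mult\<close>)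
  hence conv: "convergent_prod (\<lambda>n. 1 - a * q ^ n)"
    by (rule abs_convergent_prod_imp_convergent_prod)
  define L where "L = prodinf (\<lambda>n. 1 - a * q ^ n)"
  have "L \<noteq> 0"
    unfolding L_def using conv one_minus_mult_power_nonzero[OF assms] by (intro prodinf_nonzero) auto
  moreover have "qpochhammer a q \<longlonglongrightarrow> L"
    using convergent_prod_LIMSEQ[OF conv] unfolding L_def qpochhammer_def
    by (subst (asm) LIMSEQ_lessThan_iff_atMost[symmetric])
  ultimately show ?thesis by (rule that)
qed

lemma qpochhammer_bounds:
  assumes "norm a < 1" and "norm q < 1"
  obtains B where "0 < B" and "\<And>n. norm (qpochhammer a q n) \<le> B"
    and "\<And>n. norm (inverse (qpochhammer a q n)) \<le> B"
proof -
  obtain L where L: "L \<noteq> 0" "qpochhammer a q \<longlonglongrightarrow> L"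
    by (rule qpochhammer_tendsto_nonzero[OF assms])
  obtain B1 where B1: "\<And>n. norm (qpochhammer a q n) \<le> B1"
    using convergent_imp_Bseq[OF convergentI[OF L(2)]] by (auto simp: Bseq_def)
  obtain B2 where B2: "\<And>n. norm (inverse (qpochhammer a q n)) \<le> B2"
    using convergent_imp_Bseq[OF convergentI[OF tendsto_inverse[OF L(2,1)]]] by (auto simp: Bseq_def)
  show ?thesis
    by (rule that[of "max 1 (max B1 B2)"]) (use B1 B2 in \<open>auto simp: le_max_iff_disj\<close>)
qed

text \<open>The sign of \<open>(- x) ^ k\<close> is absorbed here, so that the polynomial is written
  in plain monomials.\<close>

definition qLaguerre_coeff :: "complex \<Rightarrow> complex \<Rightarrow> real \<Rightarrow> nat \<Rightarrow> nat \<Rightarrow> complex" where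
  "qLaguerre_coeff q lq \<alpha> n k = qbinomial q n k
     * (qpower lq ((real k)\<^sup>2 + real k * \<alpha>) / qpochhammer (qpower lq (\<alpha> + 1)) q k) * (- 1) ^ k"

lemma qLaguerre_conv_coeff:
  "qLaguerre q lq \<alpha> n x y = (\<Sum>k\<le>n. qLaguerre_coeff q lq \<alpha> n k * x ^ k * y ^ (n - k))"
  unfolding qLaguerre_def qLaguerre_coeff_def
  by (intro sum.cong refl) (simp add: power_minus[of x] mult_ac)

context
  fixes q lq :: complex
  assumes q: "0 < norm q" "norm q < 1" and lq: "exp lq = q"
begin

lemma norm_qpower_less_1: "0 < s \<Longrightarrow> norm (qpower lq s) < 1"
  using q by (simp add: norm_qpower lq powr_def mult_pos_neg)

lemma norm_qpower_le_1: "0 \<le> s \<Longrightarrow> norm (qpower lq s) \<le> 1"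
  using q by (simp add: norm_qpower lq powr_le1)

lemma qLaguerre_coeff_0: "qLaguerre_coeff q lq \<alpha> n 0 = 1"
  using qpochhammer_nonzero[OF q(2) q(2), of n]
  by (simp add: qLaguerre_coeff_def qbinomial_def qpochhammer_def qpower_def)

text \<open>Ratio of neighbouring coefficients in the fixed degree \<open>k + l + 1\<close>. The
  exponent of \<open>q\<close> grows by \<open>2 * k + \<alpha> + 1\<close>, the q-binomial changes
  by \<open>(1 - q ^ Suc l) / (1 - q ^ Suc k)\<close>, the Pochhammer denominator gains one factor,
  and the sign flips.\<close>

lemma qLaguerre_coeff_rec:
  assumes "-1 < \<alpha>"
  shows "(1 - q ^ Suc k) * (1 - qpower lq \<alpha> * q ^ Suc k) * qLaguerre_coeff q lq \<alpha> (Suc k + l) (Suc k) =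
    - qpower lq (\<alpha> + 1) * q ^ (2 * k) * (1 - q ^ Suc l) * qLaguerre_coeff q lq \<alpha> (k + Suc l) k"
proof -
  define a where "a = qpower lq (\<alpha> + 1)"
  have a: "norm a < 1" unfolding a_def using assms by (intro norm_qpower_less_1) auto
  have "a = qpower lq \<alpha> * q"
    using qpower_of_nat[OF lq, of 1] by (simp add: a_def qpower_add)
  hence fac: "1 - qpower lq \<alpha> * q ^ Suc k = 1 - a * q ^ k" by simp
  have "(real (Suc k))\<^sup>2 + real (Suc k) * \<alpha> = ((real k)\<^sup>2 + real k * \<alpha>) + real (2 * k) + (\<alpha> + 1)"
    by (simp add: power2_eq_square algebra_simps)
  hence pow: "qpower lq ((real (Suc k))\<^sup>2 + real (Suc k) * \<alpha>) =
      qpower lq ((real k)\<^sup>2 + real k * \<alpha>) * q ^ (2 * k) * a"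
    by (simp only: qpower_add qpower_of_nat[OF lq] a_def)
  have nz: "qpochhammer q q i \<noteq> 0" "qpochhammer a q i \<noteq> 0" "1 - q * q ^ i \<noteq> 0" "1 - a * q ^ i \<noteq> 0" for i
    using qpochhammer_nonzero[OF q(2) q(2)] qpochhammer_nonzero[OF a q(2)]
      one_minus_mult_power_nonzero[OF q(2) q(2)] one_minus_mult_power_nonzero[OF a q(2)] by auto
  \<comment> \<open>Here \<open>u\<close>, \<open>v\<close>, \<open>w\<close> are the last factors
    of the Pochhammer symbols of index \<open>Suc k\<close>, \<open>Suc k\<close>,
    \<open>Suc l\<close>, while \<open>A\<close>, \<open>B\<close>, \<open>D\<close> are the symbols
    before them; \<open>P\<close> is the common numerator of the q-binomials.\<close>
  have cancel: "u * v * (P / ((A * u) * B) * (E * Q * b / (D * v)) * (s * - 1)) =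
      - b * Q * w * (P / (A * (B * w)) * (E / D) * s)"
    if "u \<noteq> 0" "v \<noteq> 0" "w \<noteq> 0" "A \<noteq> 0" "B \<noteq> 0" "D \<noteq> 0" for u v w P A B E Q b D s :: complex
    using that by (simp add: field_simps)
  show ?thesis
    unfolding qLaguerre_coeff_def qbinomial_def pow fac a_def[symmetric] qpochhammer_Suc[of _ _ k]
    using cancel[OF nz(3)[of k] nz(4)[of k] nz(3)[of l] nz(1)[of k] nz(1)[of l] nz(2)[of k]]
    by (simp add: qpochhammer_Suc del: minus_mult_minus mult_minus_right)
qed

text \<open>The Pochhammer symbols and their inverses are bounded. The exponent
  \<open>k * (k + \<alpha>)\<close> of \<open>q\<close> is never negative, because
  \<open>\<alpha> > -1\<close> and \<open>k\<close> is 0 or at least 1.\<close>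

lemma qLaguerre_coeff_bound:
  assumes "-1 < \<alpha>"
  obtains C where "0 < C" "\<And>n k. norm (qLaguerre_coeff q lq \<alpha> n k) \<le> C"
proof -
  define a where "a = qpower lq (\<alpha> + 1)"
  have a: "norm a < 1" unfolding a_def using assms by (intro norm_qpower_less_1) auto
  obtain B where B: "0 < B" "\<And>n. norm (qpochhammer q q n) \<le> B" "\<And>n. norm (inverse (qpochhammer q q n)) \<le> B"
    by (rule qpochhammer_bounds[OF q(2) q(2)]) (rule that)
  obtain B' where B': "0 < B'" "\<And>n. norm (qpochhammer a q n) \<le> B'"
      "\<And>n. norm (inverse (qpochhammer a q n)) \<le> B'"
    by (rule qpochhammer_bounds[OF a q(2)]) (rule that)
  have "norm (qLaguerre_coeff q lq \<alpha> n k) \<le> B * (B * B) * (1 * B') * 1" for n k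
  proof -
    have "0 \<le> real k * (real k + \<alpha>)"
    proof (cases "k = 0")
      case False
      hence "0 \<le> real k + \<alpha>" using assms by linarith
      thus ?thesis by simp
    qed simp
    hence "norm (qpower lq ((real k)\<^sup>2 + real k * \<alpha>)) \<le> 1"
      by (intro norm_qpower_le_1) (simp add: power2_eq_square distrib_left)
    hence "norm (qpochhammer q q n * (inverse (qpochhammer q q k) * inverse (qpochhammer q q (n - k)))
        * (qpower lq ((real k)\<^sup>2 + real k * \<alpha>) * inverse (qpochhammer a q k)) * (- 1) ^ k)
        \<le> B * (B * B) * (1 * B') * 1"
      unfolding norm_mult
      by (intro mult_mono B B' norm_ge_zero mult_nonneg_nonneg less_imp_le[OF B(1)]
            less_imp_le[OF B'(1)] zero_le_one) (simp_all add: norm_power)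
    thus ?thesis by (simp add: qLaguerre_coeff_def qbinomial_def divide_inverse a_def)
  qed
  thus ?thesis by (rule that[rotated]) (use B(1) B'(1) in simp)
qed

text \<open>Comparison with the binomial expansion, whose coefficients are at least 1. The bound is
  on the sum of the moduli of the terms, as the rearrangement of the double series requires.\<close>

lemma qLaguerre_terms_bound:
  assumes "-1 < \<alpha>"
  obtains C where "0 < C" "\<And>n x y. (\<Sum>k\<le>n. norm (qLaguerre_coeff q lq \<alpha> n k * x ^ k * y ^ (n - k)))
    \<le> C * (norm x + norm y) ^ n"
proof -
  obtain C where C: "0 < C" "\<And>n k. norm (qLaguerre_coeff q lq \<alpha> n k) \<le> C"
    by (rule qLaguerre_coeff_bound[OF assms]) (rule that)
  have "(\<Sum>k\<le>n. norm (qLaguerre_coeff q lq \<alpha> n k * x ^ k * y ^ (n - k))) \<le> C * (norm x + norm y) ^ n" for n x y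
  proof -
    have "norm (qLaguerre_coeff q lq \<alpha> n k * x ^ k * y ^ (n - k))
        \<le> C * (real (n choose k) * norm x ^ k * norm y ^ (n - k))" if "k \<le> n" for k
    proof -
      have "1 \<le> real (n choose k)" using that by (simp add: Suc_le_eq)
      hence "norm (qLaguerre_coeff q lq \<alpha> n k) * 1 \<le> C * real (n choose k)"
        using C by (intro mult_mono) (auto simp: less_imp_le)
      hence "norm (qLaguerre_coeff q lq \<alpha> n k) * 1 * (norm x ^ k * norm y ^ (n - k))
          \<le> C * real (n choose k) * (norm x ^ k * norm y ^ (n - k))"
        by (intro mult_right_mono) auto
      thus ?thesis by (simp add: norm_mult norm_power mult_ac)
    qed
    hence "(\<Sum>k\<le>n. norm (qLaguerre_coeff q lq \<alpha> n k * x ^ k * y ^ (n - k)))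
        \<le> (\<Sum>k\<le>n. C * (real (n choose k) * norm x ^ k * norm y ^ (n - k)))"
      by (intro sum_mono) auto
    thus ?thesis by (simp add: binomial_ring sum_distrib_left)
  qed
  with C(1) show ?thesis by (rule that)
qed

end

text \<open>The coefficient of \<open>vmonom x m * vmonom y n\<close> in the product of q-Laguerre
  polynomials of degrees \<open>m j + n j\<close>.\<close>

definition qLaguerre_vcoeff ::
    "complex \<Rightarrow> complex \<Rightarrow> real ^ 'k \<Rightarrow> ('k::finite \<Rightarrow> nat) \<Rightarrow> ('k \<Rightarrow> nat) \<Rightarrow> complex" where
  "qLaguerre_vcoeff q lq \<alpha> m n = (\<Prod>j\<in>UNIV. qLaguerre_coeff q lq (\<alpha> $ j) (m j + n j) (m j))"

context
  fixes q lq :: complex and \<alpha> :: "real ^ 'k"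
  assumes q: "0 < norm q" "norm q < 1" and lq: "exp lq = q" and \<alpha>: "\<And>j. -1 < \<alpha> $ j"
begin

lemma qLaguerre_vcoeff_0: "qLaguerre_vcoeff q lq \<alpha> (\<lambda>_. 0) n = 1"
  by (simp add: qLaguerre_vcoeff_def qLaguerre_coeff_0[OF q lq])

lemma qLaguerre_vcoeff_rec:
  "(1 - q ^ Suc (m j)) * (1 - qpower lq (\<alpha> $ j) * q ^ Suc (m j)) * qLaguerre_vcoeff q lq \<alpha> (m(j := Suc (m j))) n =
   - qpower lq (\<alpha> $ j + 1) * q ^ (2 * m j) * (1 - q ^ Suc (n j)) * qLaguerre_vcoeff q lq \<alpha> m (n(j := Suc (n j)))"
proof -
  define R where "R = (\<Prod>i\<in>UNIV - {j}. qLaguerre_coeff q lq (\<alpha> $ i) (m i + n i) (m i))"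
  have "qLaguerre_vcoeff q lq \<alpha> (m(j := Suc (m j))) n =
      qLaguerre_coeff q lq (\<alpha> $ j) (Suc (m j) + n j) (Suc (m j)) * R"
    unfolding qLaguerre_vcoeff_def R_def by (subst prod.remove[of UNIV j]) auto
  moreover have "qLaguerre_vcoeff q lq \<alpha> m (n(j := Suc (n j))) =
      qLaguerre_coeff q lq (\<alpha> $ j) (m j + Suc (n j)) (m j) * R"
    unfolding qLaguerre_vcoeff_def R_def by (subst prod.remove[of UNIV j]) auto
  ultimately show ?thesis
    using arg_cong[OF qLaguerre_coeff_rec[OF q lq \<alpha>, of "m j" j "n j"], of "\<lambda>t. t * R"]
    by (simp only: mult.assoc)
qed

text \<open>The recurrences preserve \<open>m + n\<close>, and induction on the sum of
  \<open>m\<close> leads back to \<open>m = 0\<close>. Conversely, \<open>qLaguerre_vcoeff\<close>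
  satisfies them, and so does its product with any function of \<open>m + n\<close>.\<close>

lemma qLaguerre_recurrence_iff:
  fixes c :: "('k \<Rightarrow> nat) \<Rightarrow> ('k \<Rightarrow> nat) \<Rightarrow> complex"
  shows "(\<forall>j m n. (1 - q ^ Suc (m j)) * (1 - qpower lq (\<alpha> $ j) * q ^ Suc (m j)) * c (m(j := Suc (m j))) n =
      - qpower lq (\<alpha> $ j + 1) * q ^ (2 * m j) * (1 - q ^ Suc (n j)) * c m (n(j := Suc (n j))))
    \<longleftrightarrow> (\<forall>m n. c m n = c (\<lambda>_. 0) (\<lambda>j. m j + n j) * qLaguerre_vcoeff q lq \<alpha> m n)"
    (is "?rec \<longleftrightarrow> ?sol")
proof
  assume sol: ?sol
  show ?rec
  proof (intro allI)
    fix j and m n :: "'k \<Rightarrow> nat"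
    have "(\<lambda>i. (m(j := Suc (m j))) i + n i) = (\<lambda>i. m i + (n(j := Suc (n j))) i)" by auto
    thus "(1 - q ^ Suc (m j)) * (1 - qpower lq (\<alpha> $ j) * q ^ Suc (m j)) * c (m(j := Suc (m j))) n =
      - qpower lq (\<alpha> $ j + 1) * q ^ (2 * m j) * (1 - q ^ Suc (n j)) * c m (n(j := Suc (n j)))"
      using arg_cong[OF qLaguerre_vcoeff_rec[of m j n], of "\<lambda>t. c (\<lambda>_. 0) (\<lambda>i. m i + (n(j := Suc (n j))) i) * t"]
        sol[rule_format, of "m(j := Suc (m j))" n] sol[rule_format, of m "n(j := Suc (n j))"]
      by (simp only: mult_ac)
  qed
next
  assume rec: ?rec
  show ?sol
  proof (intro allI)
    fix m n
    show "c m n = c (\<lambda>_. 0) (\<lambda>j. m j + n j) * qLaguerre_vcoeff q lq \<alpha> m n"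
    proof (induction "\<Sum>j\<in>UNIV. m j" arbitrary: m n rule: less_induct)
      case less
      show ?case
      proof (cases "\<exists>j. m j > 0")
        case False
        hence "m = (\<lambda>_. 0)" by auto
        thus ?thesis by (simp add: qLaguerre_vcoeff_0)
      next
        case True
        then obtain j where j: "m j > 0" by blast
        \<comment> \<open>The recurrence at \<open>m'\<close> and \<open>n\<close> expresses
          \<open>c m n\<close> through \<open>c m' (n(j := Suc (n j)))\<close>, where one unit has
          moved from \<open>m\<close> to \<open>n\<close>.\<close>
        define m' where "m' = m(j := m j - 1)"
        have m: "m = m'(j := Suc (m' j))" using j by (auto simp: m'_def)
        have "(\<Sum>j\<in>UNIV. m' j) < (\<Sum>j\<in>UNIV. m j)"
          using j by (intro sum_strict_mono_ex1) (auto simp: m'_def intro!: exI[of _ j])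
        from less[OF this, of "n(j := Suc (n j))"]
        have IH: "c m' (n(j := Suc (n j))) =
            c (\<lambda>_. 0) (\<lambda>i. m' i + (n(j := Suc (n j))) i) * qLaguerre_vcoeff q lq \<alpha> m' (n(j := Suc (n j)))" .
        have add: "(\<lambda>i. m' i + (n(j := Suc (n j))) i) = (\<lambda>i. m i + n i)" unfolding m by auto
        \<comment> \<open>The factor to be cancelled. It is nonzero because \<open>q\<close> and
          \<open>q\<close> to the power \<open>\<alpha> $ j + 1\<close> both have modulus below
          1.\<close>
        define u where "u = (1 - q ^ Suc (m' j)) * (1 - qpower lq (\<alpha> $ j) * q ^ Suc (m' j))"
        have "qpower lq (\<alpha> $ j) * q ^ Suc (m' j) = qpower lq (\<alpha> $ j + 1) * q ^ m' j"
          using qpower_of_nat[OF lq, of 1] by (simp add: qpower_add mult.assoc)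
        moreover have "norm (qpower lq (\<alpha> $ j + 1)) < 1"
          using \<alpha>[of j] by (intro norm_qpower_less_1[OF q lq]) linarith
        ultimately have "u \<noteq> 0"
          using one_minus_mult_power_nonzero[OF q(2) q(2), of "m' j"]
            one_minus_mult_power_nonzero[OF _ q(2), of "qpower lq (\<alpha> $ j + 1)" "m' j"]
          by (simp only: u_def mult_eq_0_iff power_Suc) simp
        have "u * c m n =
            - qpower lq (\<alpha> $ j + 1) * q ^ (2 * m' j) * (1 - q ^ Suc (n j)) * c m' (n(j := Suc (n j)))"
          unfolding u_def by (subst m) (rule rec[rule_format])
        also have "\<dots> = c (\<lambda>_. 0) (\<lambda>i. m i + n i) * (u * qLaguerre_vcoeff q lq \<alpha> m n)"
          using qLaguerre_vcoeff_rec[of m' j n] unfolding IH add u_def m[symmetric] by (simp only: mult_ac)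
        finally show ?thesis using \<open>u \<noteq> 0\<close> by simp
      qed
    qed
  qed
qed

end

subsection \<open>Rearrangement of the expansion\<close>

context
  fixes q lq :: complex and \<alpha> :: "real ^ 'k"
  assumes q: "0 < norm q" "norm q < 1" and lq: "exp lq = q" and \<alpha>: "\<And>j. -1 < \<alpha> $ j"
begin

text \<open>
  Both sums are iterated and reindexed forms of one absolutely convergent sum over the pairs
  \<open>(N, m)\<close> with \<open>m \<le> N\<close>: summing over \<open>m\<close> first gives the product of q-Laguerre polynomials, and
  \<open>(m, n) \<mapsto> (m + n, m)\<close> gives the power series.
\<close>

lemma qLaguerre_series_eq_pseries:
  fixes coef :: "('k \<Rightarrow> nat) \<Rightarrow> complex" and x y :: "complex ^ 'k"
  assumes summable: "(\<lambda>N. norm (coef N) * (\<Prod>j\<in>UNIV. s ^ N j)) summable_on UNIV"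
    and s: "\<And>j. norm (x $ j) + norm (y $ j) \<le> s"
  obtains S where
    "((\<lambda>N. coef N * (\<Prod>j\<in>UNIV. qLaguerre q lq (\<alpha> $ j) (N j) (x $ j) (y $ j))) has_sum S) UNIV"
    "((\<lambda>(m, n). coef (\<lambda>j. m j + n j) * qLaguerre_vcoeff q lq \<alpha> m n * vmonom x m * vmonom y n) has_sum S) UNIV"
proof -
  define t where "t j N k = qLaguerre_coeff q lq (\<alpha> $ j) N k * x $ j ^ k * y $ j ^ (N - k)" for j N k
  define F where "F p = coef (fst p) * (\<Prod>j\<in>UNIV. t j (fst p j) (snd p j))" for p
  define I where "I N = (\<Pi>\<^sub>E j\<in>UNIV. {..N j})" for N :: "'k \<Rightarrow> nat"
  have fin: "finite (I N)" for N unfolding I_def by (intro finite_PiE) auto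
  have "\<exists>C>0. \<forall>N. (\<Sum>k\<le>N. norm (t j N k)) \<le> C * (norm (x $ j) + norm (y $ j)) ^ N" for j
    using qLaguerre_terms_bound[OF q lq \<alpha>[of j]] unfolding t_def by metis
  then obtain C where C: "\<And>j. 0 < C j"
    "\<And>j N. (\<Sum>k\<le>N. norm (t j N k)) \<le> C j * (norm (x $ j) + norm (y $ j)) ^ N" by metis
  \<comment> \<open>For fixed \<open>N\<close> the sum over the box \<open>I N\<close> factors into
    one sum per coordinate, so it is at most a constant times the \<open>N\<close>-th term of the
    assumed series.\<close>
  have "(\<lambda>p. norm (F p)) summable_on Sigma UNIV I"
  proof (rule summable_on_SigmaI)
    show "((\<lambda>m. norm (F (N, m))) has_sum (\<Sum>m\<in>I N. norm (F (N, m)))) (I N)" for N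
      by (rule has_sum_finite[OF fin])
    have "(\<Sum>m\<in>I N. norm (F (N, m))) \<le> (\<Prod>j\<in>UNIV. C j) * (norm (coef N) * (\<Prod>j\<in>UNIV. s ^ N j))" for N
    proof -
      have "(\<Sum>m\<in>I N. norm (F (N, m))) = norm (coef N) * (\<Sum>m\<in>I N. \<Prod>j\<in>UNIV. norm (t j (N j) (m j)))"
        by (simp add: F_def norm_mult prod_norm sum_distrib_left)
      also have "\<dots> = norm (coef N) * (\<Prod>j\<in>UNIV. \<Sum>k\<le>N j. norm (t j (N j) k))"
        unfolding I_def by (subst prod_sum_PiE) auto
      also have "\<dots> \<le> norm (coef N) * (\<Prod>j\<in>UNIV. C j * s ^ N j)"
      proof (intro mult_left_mono prod_mono conjI norm_ge_zero sum_nonneg)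
        fix j
        have "(norm (x $ j) + norm (y $ j)) ^ N j \<le> s ^ N j" by (intro power_mono s) auto
        thus "(\<Sum>k\<le>N j. norm (t j (N j) k)) \<le> C j * s ^ N j"
          using C(1)[of j] C(2)[of j "N j"] by (meson less_imp_le mult_left_mono order_trans)
      qed
      finally show ?thesis by (simp add: prod.distrib mult_ac)
    qed
    from Infinite_Sum.abs_summable_on_comparison_test'[OF summable_on_cmult_right[OF summable, of "\<Prod>j\<in>UNIV. C j"],
        of "\<lambda>N. \<Sum>m\<in>I N. norm (F (N, m))"] this
    show "(\<lambda>N. \<Sum>m\<in>I N. norm (F (N, m))) summable_on UNIV"
      by (simp add: sum_nonneg)
  qed auto
  hence "F summable_on Sigma UNIV I" by (rule abs_summable_summable)
  then obtain S where S: "(F has_sum S) (Sigma UNIV I)" by (auto simp: summable_on_def)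
  have "((\<lambda>N. coef N * (\<Prod>j\<in>UNIV. qLaguerre q lq (\<alpha> $ j) (N j) (x $ j) (y $ j))) has_sum S) UNIV"
  proof (rule has_sum_SigmaD[OF S])
    fix N
    have "(\<Sum>m\<in>I N. F (N, m)) = coef N * (\<Prod>j\<in>UNIV. qLaguerre q lq (\<alpha> $ j) (N j) (x $ j) (y $ j))"
      unfolding F_def qLaguerre_conv_coeff t_def[symmetric] I_def
      by (subst prod_sum_PiE) (simp_all add: sum_distrib_left)
    thus "((\<lambda>m. F (N, m)) has_sum
        coef N * (\<Prod>j\<in>UNIV. qLaguerre q lq (\<alpha> $ j) (N j) (x $ j) (y $ j))) (I N)"
      using has_sum_finite[OF fin, of "\<lambda>m. F (N, m)" N] by simp
  qed
  moreover have "((\<lambda>(m, n). coef (\<lambda>j. m j + n j) * qLaguerre_vcoeff q lq \<alpha> m n * vmonom x m * vmonom y n)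
      has_sum S) UNIV"
  proof -
    \<comment> \<open>The inverse subtracts \<open>m\<close> from \<open>N\<close>; no truncation
      occurs, since \<open>m\<close> lies in the box below \<open>N\<close>.\<close>
    have bij: "bij_betw (\<lambda>p. (\<lambda>j. fst p j + snd p j, fst p)) UNIV (Sigma UNIV I)"
      by (rule bij_betw_byWitness[of _ "\<lambda>p. (snd p, \<lambda>j. fst p j - snd p j)"])
         (auto simp: I_def fun_eq_iff PiE_iff)
    have "F (\<lambda>j. fst p j + snd p j, fst p) = (case p of (m, n) \<Rightarrow>
        coef (\<lambda>j. m j + n j) * qLaguerre_vcoeff q lq \<alpha> m n * vmonom x m * vmonom y n)" for p
      by (cases p) (simp add: F_def t_def qLaguerre_vcoeff_def vmonom_def prod.distrib mult_ac)
    with has_sum_reindex_bij_betw[OF bij, THEN iffD2, OF S] show ?thesis by simp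
  qed
  ultimately show ?thesis by (rule that)
qed

text \<open>Both sides of the equation have power series on the polydisc of radius \<open>r\<close>,
  so they agree near the origin exactly when their coefficients agree. The factor
  \<open>q ^ (2 * m j)\<close> comes from the double shift.\<close>

lemma qpde_iff_recurrence:
  assumes "0 < r" and f: "has_pseries r f c"
  shows "(\<forall>\<^sub>F (x, y) in nhds (0, 0).
      qderiv_x q j (\<lambda>x y. f x y - qpower lq (\<alpha> $ j) * qshift_x q 1 j f x y) x y =
      - qpower lq (\<alpha> $ j + 1) * qshift_x q 2 j (qderiv_y q j f) x y) \<longleftrightarrow>
    (\<forall>m n. (1 - q ^ Suc (m j)) * (1 - qpower lq (\<alpha> $ j) * q ^ Suc (m j)) * c (m(j := Suc (m j))) n =
      - qpower lq (\<alpha> $ j + 1) * q ^ (2 * m j) * (1 - q ^ Suc (n j)) * c m (n(j := Suc (n j))))"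
    (is "?pde \<longleftrightarrow> (\<forall>m n. ?c m n = ?d m n)")
proof -
  let ?L = "qderiv_x q j (\<lambda>x y. f x y - qpower lq (\<alpha> $ j) * qshift_x q 1 j f x y)"
  let ?R = "\<lambda>x y. - qpower lq (\<alpha> $ j + 1) * qshift_x q 2 j (qderiv_y q j f) x y"
  have q1: "norm q \<le> 1" using q by simp
  have L: "has_pseries r ?L ?c"
    using has_pseries_qderiv_x[OF has_pseries_diff[OF f has_pseries_cmult[OF has_pseries_qshift_x[OF f q1, of 1 j],
        of "qpower lq (\<alpha> $ j)"]] q(2), of j]
    by (simp add: algebra_simps)
  have R: "has_pseries r ?R ?d"
    using has_pseries_cmult[OF has_pseries_qshift_x[OF has_pseries_qderiv_y[OF f q(2), of j] q1, of 2 j],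
        of "- qpower lq (\<alpha> $ j + 1)"]
    by (simp add: mult.assoc)
  show ?thesis
  proof
    assume ?pde
    then obtain r' where r': "0 < r'" "\<And>x y. (\<forall>j. norm (x $ j) < r') \<Longrightarrow> (\<forall>j. norm (y $ j) < r') \<Longrightarrow> ?L x y = ?R x y"
      unfolding eventually_nhds_polydisc by blast
    \<comment> \<open>The equation is only known on a polydisc of radius \<open>r'\<close>, possibly
      smaller than \<open>r\<close>.\<close>
    have "?c m n = ?d m n" for m n
    proof (rule has_pseries_unique[where c = ?c and d = ?d])
      show "0 < min r r'" using \<open>0 < r\<close> \<open>0 < r'\<close> by simp
      show "has_pseries (min r r') ?L ?c" by (rule has_pseries_mono[OF L]) simp
      show "has_pseries (min r r') ?R ?d" by (rule has_pseries_mono[OF R]) simp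
      show "?L x y = ?R x y" if "\<And>j. norm (x $ j) < min r r'" "\<And>j. norm (y $ j) < min r r'" for x y
        by (rule r'(2)) (use that in auto)
    qed
    thus "\<forall>m n. ?c m n = ?d m n" by blast
  next
    assume eq: "\<forall>m n. ?c m n = ?d m n"
    have "?L x y = ?R x y" if "\<forall>j. norm (x $ j) < r" "\<forall>j. norm (y $ j) < r" for x y
    proof (rule has_sum_unique)
      show "((\<lambda>(m, n). ?c m n * vmonom x m * vmonom y n) has_sum ?L x y) UNIV"
        by (rule has_pseriesD[OF L]) (use that in auto)
      show "((\<lambda>(m, n). ?c m n * vmonom x m * vmonom y n) has_sum ?R x y) UNIV"
        unfolding eq[rule_format] by (rule has_pseriesD[OF R]) (use that in auto)
    qed
    thus ?pde unfolding eventually_nhds_polydisc using \<open>0 < r\<close> by blast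
  qed
qed

end

section \<open>The two directions of the equivalence\<close>

theorem theorem2p3:
  fixes q lq :: complex
    and \<alpha> :: "real ^ 'k"
    and f :: "complex ^ 'k \<Rightarrow> complex ^ 'k \<Rightarrow> complex"
  assumes "0 < cmod q" and "cmod q < 1"
    and "exp lq = q"
    and "\<And>j. \<alpha> $ j > -1"
    and "analytic_at_origin f"
  shows "(\<exists>coef :: ('k \<Rightarrow> nat) \<Rightarrow> complex.
            \<forall>\<^sub>F (x, y) in nhds (0, 0).
              abs_has_sum
                (\<lambda>n. coef n * (\<Prod>j\<in>UNIV. qLaguerre q lq (\<alpha> $ j) (n j) (x $ j) (y $ j)))
                (f x y))
         \<longleftrightarrow>
         (\<forall>j. \<forall>\<^sub>F (x, y) in nhds (0, 0).
            qderiv_x q j (\<lambda>x y. f x y - qpower lq (\<alpha> $ j) * qshift_x q 1 j f x y) x y =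
            - qpower lq (\<alpha> $ j + 1) * qshift_x q 2 j (qderiv_y q j f) x y)"
    (is "(\<exists>coef. ?expansion coef) \<longleftrightarrow> ?pde")
proof
  assume "\<exists>coef. ?expansion coef"
  then obtain coef r where "0 < r" and
    r: "\<And>x y. (\<forall>j. norm (x $ j) < r) \<Longrightarrow> (\<forall>j. norm (y $ j) < r) \<Longrightarrow>
      ((\<lambda>n. coef n * (\<Prod>j\<in>UNIV. qLaguerre q lq (\<alpha> $ j) (n j) (x $ j) (y $ j))) has_sum f x y) UNIV"
    unfolding eventually_nhds_polydisc abs_has_sum_iff by blast
  \<comment> \<open>The point with \<open>x = 0\<close> and all coordinates of \<open>y\<close>
    equal to \<open>s\<close> lies in the polydisc. The expansion there is the series of
    \<open>coef n\<close> times powers of \<open>s\<close>. Later \<open>x\<close> and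
    \<open>y\<close> are kept within \<open>s / 2\<close>, so that the moduli of
    \<open>x $ j\<close> and \<open>y $ j\<close> add up to at most \<open>s\<close>.\<close>
  define s where "s = r / 2"
  have s: "0 < s" "s < r" using \<open>0 < r\<close> by (auto simp: s_def)
  have "qLaguerre q lq \<beta> n 0 y = y ^ n" for \<beta> n y
  proof -
    have "qLaguerre q lq \<beta> n 0 y = (\<Sum>k\<in>{0}. qLaguerre_coeff q lq \<beta> n k * 0 ^ k * y ^ (n - k))"
      unfolding qLaguerre_conv_coeff by (intro sum.mono_neutral_right) auto
    thus ?thesis by (simp add: qLaguerre_coeff_0[OF assms(1-3)])
  qed
  hence "(\<lambda>n. coef n * (\<Prod>j\<in>UNIV. complex_of_real s ^ n j)) summable_on UNIV"
    using has_sum_imp_summable[OF r[of 0 "\<chi> j. of_real s"]] s \<open>0 < r\<close> by simp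
  hence summable: "(\<lambda>n. norm (coef n) * (\<Prod>j\<in>UNIV. s ^ n j)) summable_on UNIV"
    unfolding summable_on_iff_abs_summable_on_complex
    using s by (simp add: norm_mult norm_power flip: prod_norm)
  let ?c = "\<lambda>m n. coef (\<lambda>j. m j + n j) * qLaguerre_vcoeff q lq \<alpha> m n"
  have "has_pseries (s / 2) f ?c"
    unfolding has_pseries_def
  proof (intro allI impI)
    fix x y :: "complex ^ 'k"
    assume xy: "\<forall>j. norm (x $ j) < s / 2" "\<forall>j. norm (y $ j) < s / 2"
    have "norm (x $ j) + norm (y $ j) \<le> s" for j
      using xy[rule_format, of j] by linarith
    then obtain S where S:
      "((\<lambda>N. coef N * (\<Prod>j\<in>UNIV. qLaguerre q lq (\<alpha> $ j) (N j) (x $ j) (y $ j))) has_sum S) UNIV"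
      "((\<lambda>(m, n). ?c m n * vmonom x m * vmonom y n) has_sum S) UNIV"
      by (rule qLaguerre_series_eq_pseries[OF assms(1-4) summable]) (rule that)
    have "norm (x $ j) < r" "norm (y $ j) < r" for j
      using xy[rule_format, of j] s by linarith+
    hence "S = f x y" by (intro has_sum_unique[OF S(1) r]) auto
    with S(2) show "((\<lambda>(m, n). ?c m n * vmonom x m * vmonom y n) has_sum f x y) UNIV" by simp
  qed
  note pde = qpde_iff_recurrence[OF assms(1-4) _ this]
  \<comment> \<open>The coefficients are already in solved form: at \<open>m = 0\<close> the factor
    \<open>qLaguerre_vcoeff\<close> is 1, so \<open>?c\<close> equals \<open>coef\<close>
    there.\<close>
  have "\<forall>m n. ?c m n = ?c (\<lambda>_. 0) (\<lambda>j. m j + n j) * qLaguerre_vcoeff q lq \<alpha> m n"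
    by (simp add: qLaguerre_vcoeff_0[OF assms(1-4)])
  from qLaguerre_recurrence_iff[OF assms(1-4), THEN iffD2, OF this]
  show ?pde using s by (subst pde) simp_all
next
  assume pde: ?pde
  obtain r c where "0 < r" and f: "has_pseries r f c"
    by (rule analytic_at_origin_has_pseries[OF assms(5)]) (rule that)
  \<comment> \<open>The only possible choice, since the q-Laguerre product of degree
    \<open>N\<close> reduces to \<open>vmonom y N\<close> at \<open>x = 0\<close>.\<close>
  define coef where "coef = c (\<lambda>_. 0)"
  have c: "c m n = coef (\<lambda>j. m j + n j) * qLaguerre_vcoeff q lq \<alpha> m n" for m n
    using qLaguerre_recurrence_iff[OF assms(1-4), THEN iffD1] pde
    unfolding qpde_iff_recurrence[OF assms(1-4) \<open>0 < r\<close> f] coef_def by blast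
  define s where "s = r / 2"
  have s: "0 < s" "s < r" using \<open>0 < r\<close> by (auto simp: s_def)
  let ?v = "\<chi> j. complex_of_real s"
  have "(\<lambda>(m, n). c m n * vmonom ?v m * vmonom ?v n) summable_on UNIV"
    by (rule has_sum_imp_summable[OF has_pseriesD[OF f]]) (use s in auto)
  \<comment> \<open>Keeping only the pairs with \<open>m = 0\<close> leaves the series of
    \<open>coef\<close> at \<open>s\<close>.\<close>
  hence "(\<lambda>(m, n). c m n * vmonom ?v m * vmonom ?v n) summable_on range (Pair (\<lambda>_. 0))"
    by (rule summable_on_subset) auto
  hence "(\<lambda>n. coef n * (\<Prod>j\<in>UNIV. complex_of_real s ^ n j)) summable_on UNIV"
    by (subst (asm) summable_on_reindex) (auto simp: o_def coef_def vmonom_def inj_on_def)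
  hence summable: "(\<lambda>n. norm (coef n) * (\<Prod>j\<in>UNIV. s ^ n j)) summable_on UNIV"
    unfolding summable_on_iff_abs_summable_on_complex
    using s by (simp add: norm_mult norm_power flip: prod_norm)
  have "((\<lambda>n. coef n * (\<Prod>j\<in>UNIV. qLaguerre q lq (\<alpha> $ j) (n j) (x $ j) (y $ j))) has_sum f x y) UNIV"
    if xy: "\<forall>j. norm (x $ j) < s / 2" "\<forall>j. norm (y $ j) < s / 2" for x y
  proof -
    have "norm (x $ j) + norm (y $ j) \<le> s" for j
      using xy[rule_format, of j] by linarith
    then obtain S where S:
      "((\<lambda>N. coef N * (\<Prod>j\<in>UNIV. qLaguerre q lq (\<alpha> $ j) (N j) (x $ j) (y $ j))) has_sum S) UNIV"
      "((\<lambda>(m, n). coef (\<lambda>j. m j + n j) * qLaguerre_vcoeff q lq \<alpha> m n * vmonom x m * vmonom y n) has_sum S) UNIV"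
      by (rule qLaguerre_series_eq_pseries[OF assms(1-4) summable]) (rule that)
    have "norm (x $ j) < r" "norm (y $ j) < r" for j
      using xy[rule_format, of j] s by linarith+
    hence "S = f x y"
      by (intro has_sum_unique[OF S(2) has_pseriesD[OF f, unfolded c]]) auto
    with S(1) show ?thesis by simp
  qed
  hence "?expansion coef"
    unfolding eventually_nhds_polydisc abs_has_sum_iff using s by (intro exI[of _ "s / 2"]) simp
  thus "\<exists>coef. ?expansion coef" by blast
qed

end
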